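(* Let $X$ be a metric space, $\varphi_1,\varphi_2\colon X\to\mathbb{R}_\infty$, and $U\subset X$ with $\operatorname{dom}\varphi_1\cap\operatorname{dom}\varphi_2\cap U\ne\emptyset$. Suppose that $\varphi_1$ and $\varphi_2$ are lower semicontinuous on $U$ and $\inf_U\varphi_2>-\infty$. (i) The pair $(\varphi_1,\varphi_2)$ is uniformly lower semicontinuous on $U$ if $\{x\in U\mid\varphi_1(x)\le c\}$ is compact for each $c\in\mathbb{R}$. If, additionally, $$\limsup_{\substack{d(x_1,x_2)\to0\\ x_1\in\operatorname{dom}\varphi_1\cap U,\,x_2\in\operatorname{dom}\varphi_2\cap U}}(\varphi_1(x_1)+\varphi_2(x_2))<+\infty,$$ then it is firmly uniformly lower semicontinuous on $U$. (ii) The pair $(\varphi_1,\varphi_2)$ is quasiuniformly lower semicontinuous on $U$ if $\{x\in\operatorname{cl}V\mid\varphi_1(x)\le c\}$ is compact for each $V\in EI(U)$ and $c\in\mathbb{R}$. If, additionally, $$\sup_{V\in EI(U)}\ \limsup_{\substack{d(x_1,x_2)\to0\\ x_1\in\operatorname{dom}\varphi_1\cap V,\,x_2\in\operatorname{dom}\varphi_2}}(\varphi_1(x_1)+\varphi_2(x_2))<+\infty,$$ then it is firmly quasiuniformly lower semicontinuous on $U$.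
   Context: $\mathbb{R}_\infty:=\mathbb{R}\cup\{+\infty\}$, $\operatorname{dom}\varphi:=\{x\mid\varphi(x)<+\infty\}$, $\operatorname{cl}$ is closure, $\inf\emptyset=+\infty$. A set $V\subset X$ is an essentially interior subset of $U$ if $\bigcup_{x\in V}B_\rho(x)\subset U$ for some $\rho>0$ ($B_\rho$ = open ball); $EI(U)$ is the collection of all such $V$ (including $\emptyset$). A liminf (limsup) as $d(x_1,x_2)\to0$ over indicated pairs means $\lim_{\eta\downarrow0}$ of the infimum (supremum) over such pairs with $d(x_1,x_2)<\eta$. Put $$\Lambda_U^\circ(\varphi_1,\varphi_2):=\liminf_{d(x_1,x_2)\to0;\;x_1,x_2\in U}(\varphi_1(x_1)+\varphi_2(x_2)),\qquad \Lambda_U^\dagger(\varphi_1,\varphi_2):=\inf_{V\in EI(U)}\Lambda_V^\circ(\varphi_1,\varphi_2),$$ and, for $x_1\in\operatorname{dom}\varphi_1$, $x_2\in\operatorname{dom}\varphi_2$, $$(\varphi_1\diamondsuit\varphi_2)_U(x_1,x_2):=\inf_{x\in U}\max\{d(x,x_1),\,d(x,x_2),\,(\varphi_1+\varphi_2)(x)-\varphi_1(x_1)-\varphi_2(x_2)\},$$ $$\Theta_U^\circ(\varphi_1,\varphi_2):=\limsup_{\substack{d(x_1,x_2)\to0\\ x_1\in\operatorname{dom}\varphi_1\cap U,\,x_2\in\operatorname{dom}\varphi_2\cap U}}(\varphi_1\diamondsuit\varphi_2)_U(x_1,x_2),\quad \Theta_U^\dagger(\varphi_1,\varphi_2):=\sup_{V\in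 EI(U)}\ \limsup_{\substack{d(x_1,x_2)\to0\\ x_1\in\operatorname{dom}\varphi_1\cap V,\,x_2\in\operatorname{dom}\varphi_2\cap V}}(\varphi_1\diamondsuit\varphi_2)_U(x_1,x_2),$$ with the supremum of the (nonnegative) quantity $\diamondsuit$ over an empty set being $0$; in the two displayed conditions of the claim a supremum over an empty set counts as $<+\infty$. The pair $(\varphi_1,\varphi_2)$ is, on $U$: uniformly lower semicontinuous if $\inf_U(\varphi_1+\varphi_2)\le\Lambda_U^\circ(\varphi_1,\varphi_2)$; quasiuniformly lower semicontinuous if $\inf_U(\varphi_1+\varphi_2)\le\Lambda_U^\dagger(\varphi_1,\varphi_2)$; firmly uniformly lower semicontinuous if $\Theta_U^\circ(\varphi_1,\varphi_2)=0$; firmly quasiuniformly lower semicontinuous if $\Theta_U^\dagger(\varphi_1,\varphi_2)=0$. *)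

theory Defs
  imports "HOL-Analysis.Analysis"
begin

text \<open>Functions with values in $\mathbb{R} \cup \{+\infty\}$ are functions into \<^typ>\<open>ereal\<close>
  that never take the value \<^term>\<open>-\<infinity> :: ereal\<close>; the latter is a hypothesis of the theorem.\<close>

definition edom :: "('a \<Rightarrow> ereal) \<Rightarrow> 'a set" where
  "edom \<phi> = {x. \<phi> x < \<infinity>}"

text \<open>Lower semicontinuity of the restriction of \<open>\<phi>\<close> to \<open>U\<close>, analogous to \<^const>\<open>continuous_on\<close>.
  It is implied by lower semicontinuity of \<open>\<phi>\<close> on the whole space at every point of \<open>U\<close>.\<close>

definition lsc_on :: "'a::topological_space set \<Rightarrow> ('a \<Rightarrow> ereal) \<Rightarrow> bool" where
  "lsc_on U \<phi> \<longleftrightarrow> (\<forall>x\<in>U. \<phi> x \<le> Liminf (at x within U) \<phi>)"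

definition EI :: "'a::metric_space set \<Rightarrow> 'a set set" where
  "EI U = {V. \<exists>\<rho>>0. (\<Union>x\<in>V. ball x \<rho>) \<subseteq> U}"

definition close_pairs :: "'a::metric_space set \<Rightarrow> 'a set \<Rightarrow> real \<Rightarrow> ('a \<times> 'a) set" where
  "close_pairs A B \<eta> = {(x1, x2). x1 \<in> A \<and> x2 \<in> B \<and> dist x1 x2 < \<eta>}"

text \<open>The lower and upper limits as \<open>dist x1 x2\<close> tends to 0 over \<open>x1 \<in> A\<close>, \<open>x2 \<in> B\<close>. The pairs
  with \<open>x1 = x2\<close> are included. By monotonicity in \<open>\<eta>\<close> the limits exist; see the lemmas below.\<close>

definition liminf_close ::
  "'a::metric_space set \<Rightarrow> 'a set \<Rightarrow> ('a \<Rightarrow> 'a \<Rightarrow> ereal) \<Rightarrow> ereal" where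
  "liminf_close A B f = Lim (at_right 0) (\<lambda>\<eta>. INF (x1, x2)\<in>close_pairs A B \<eta>. f x1 x2)"

definition limsup_close ::
  "'a::metric_space set \<Rightarrow> 'a set \<Rightarrow> ('a \<Rightarrow> 'a \<Rightarrow> ereal) \<Rightarrow> ereal" where
  "limsup_close A B f = Lim (at_right 0) (\<lambda>\<eta>. SUP (x1, x2)\<in>close_pairs A B \<eta>. f x1 x2)"

text \<open>In \<^const>\<open>limsup_close\<close> the supremum over the empty set is \<^term>\<open>-\<infinity> :: ereal\<close>.
  For nonnegative quantities it is 0 instead.\<close>

definition Sup_nonneg :: "ereal set \<Rightarrow> ereal" where
  "Sup_nonneg S = (if S = {} then 0 else Sup S)"

definition limsup_close_nonneg ::
  "'a::metric_space set \<Rightarrow> 'a set \<Rightarrow> ('a \<Rightarrow> 'a \<Rightarrow> ereal) \<Rightarrow> ereal" where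
  "limsup_close_nonneg A B f =
     Lim (at_right 0) (\<lambda>\<eta>. Sup_nonneg ((\<lambda>(x1, x2). f x1 x2) ` close_pairs A B \<eta>))"

lemma close_pairs_mono: "\<eta> \<le> \<eta>' \<Longrightarrow> close_pairs A B \<eta> \<subseteq> close_pairs A B \<eta>'"
  by (auto simp: close_pairs_def)

lemma Lim_at_right_0_antimono:
  fixes g :: "real \<Rightarrow> ereal"
  assumes "\<And>x y. 0 < x \<Longrightarrow> x \<le> y \<Longrightarrow> g y \<le> g x"
  shows "(g \<longlongrightarrow> (SUP \<eta>\<in>{0<..}. g \<eta>)) (at_right 0)"
proof (rule increasing_tendsto)
  show "\<forall>\<^sub>F \<eta> in at_right 0. g \<eta> \<le> (SUP \<eta>\<in>{0<..}. g \<eta>)"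
    by (auto simp: eventually_at_filter intro!: always_eventually SUP_upper)
next
  fix y assume "y < (SUP \<eta>\<in>{0<..}. g \<eta>)"
  then obtain \<eta> where "\<eta> > 0" "y < g \<eta>" by (auto simp: less_SUP_iff)
  then show "\<forall>\<^sub>F x in at_right 0. y < g x"
    using assms by (auto simp: eventually_at_right_field intro!: exI[of _ \<eta>] less_le_trans[of y "g \<eta>"])
qed

lemma Lim_at_right_0_mono:
  fixes g :: "real \<Rightarrow> ereal"
  assumes "\<And>x y. 0 < x \<Longrightarrow> x \<le> y \<Longrightarrow> g x \<le> g y"
  shows "(g \<longlongrightarrow> (INF \<eta>\<in>{0<..}. g \<eta>)) (at_right 0)"
proof (rule decreasing_tendsto)
  show "\<forall>\<^sub>F \<eta> in at_right 0. (INF \<eta>\<in>{0<..}. g \<eta>) \<le> g \<eta>"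
    by (auto simp: eventually_at_filter intro!: always_eventually INF_lower)
next
  fix y assume "(INF \<eta>\<in>{0<..}. g \<eta>) < y"
  then obtain \<eta> where "\<eta> > 0" "g \<eta> < y" by (auto simp: INF_less_iff)
  then show "\<forall>\<^sub>F x in at_right 0. g x < y"
    using assms by (auto simp: eventually_at_right_field intro!: exI[of _ \<eta>] le_less_trans[of _ "g \<eta>" y])
qed

lemma liminf_close_eq:
  "liminf_close A B f = (SUP \<eta>\<in>{0<..}. INF (x1, x2)\<in>close_pairs A B \<eta>. f x1 x2)"
  unfolding liminf_close_def
  by (intro tendsto_Lim Lim_at_right_0_antimono INF_superset_mono close_pairs_mono) auto

lemma limsup_close_eq:
  "limsup_close A B f = (INF \<eta>\<in>{0<..}. SUP (x1, x2)\<in>close_pairs A B \<eta>. f x1 x2)"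
  unfolding limsup_close_def
  by (intro tendsto_Lim Lim_at_right_0_mono SUP_subset_mono close_pairs_mono) auto

lemma Sup_nonneg_mono:
  assumes "S \<subseteq> T" "\<And>t. t \<in> T \<Longrightarrow> 0 \<le> t"
  shows "Sup_nonneg S \<le> Sup_nonneg T"
  using assms by (auto simp: Sup_nonneg_def Sup_subset_mono intro: Sup_upper2)

lemma limsup_close_nonneg_eq:
  assumes "\<And>x1 x2. x1 \<in> A \<Longrightarrow> x2 \<in> B \<Longrightarrow> 0 \<le> f x1 x2"
  shows "limsup_close_nonneg A B f =
    (INF \<eta>\<in>{0<..}. Sup_nonneg ((\<lambda>(x1, x2). f x1 x2) ` close_pairs A B \<eta>))"
  unfolding limsup_close_nonneg_def
  by (intro tendsto_Lim Lim_at_right_0_mono Sup_nonneg_mono image_mono close_pairs_mono)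
     (use assms in \<open>auto simp: close_pairs_def\<close>)

definition Lambda_circ ::
  "'a::metric_space set \<Rightarrow> ('a \<Rightarrow> ereal) \<Rightarrow> ('a \<Rightarrow> ereal) \<Rightarrow> ereal" where
  "Lambda_circ U \<phi>1 \<phi>2 = liminf_close U U (\<lambda>x1 x2. \<phi>1 x1 + \<phi>2 x2)"

definition Lambda_dagger ::
  "'a::metric_space set \<Rightarrow> ('a \<Rightarrow> ereal) \<Rightarrow> ('a \<Rightarrow> ereal) \<Rightarrow> ereal" where
  "Lambda_dagger U \<phi>1 \<phi>2 = (INF V\<in>EI U. Lambda_circ V \<phi>1 \<phi>2)"

text \<open>Only used for \<open>x1 \<in> edom \<phi>1\<close>, \<open>x2 \<in> edom \<phi>2\<close>, so that the subtracted values are finite.\<close>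

definition diamond ::
  "'a::metric_space set \<Rightarrow> ('a \<Rightarrow> ereal) \<Rightarrow> ('a \<Rightarrow> ereal) \<Rightarrow> 'a \<Rightarrow> 'a \<Rightarrow> ereal" where
  "diamond U \<phi>1 \<phi>2 x1 x2 =
     (INF x\<in>U. Max {ereal (dist x x1), ereal (dist x x2), (\<phi>1 x + \<phi>2 x) - \<phi>1 x1 - \<phi>2 x2})"

lemma diamond_nonneg: "0 \<le> diamond U \<phi>1 \<phi>2 x1 x2"
  by (auto simp: diamond_def intro!: INF_greatest simp: le_max_iff_disj)

definition Theta_circ ::
  "'a::metric_space set \<Rightarrow> ('a \<Rightarrow> ereal) \<Rightarrow> ('a \<Rightarrow> ereal) \<Rightarrow> ereal" where
  "Theta_circ U \<phi>1 \<phi>2 =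
     limsup_close_nonneg (edom \<phi>1 \<inter> U) (edom \<phi>2 \<inter> U) (diamond U \<phi>1 \<phi>2)"

definition Theta_dagger ::
  "'a::metric_space set \<Rightarrow> ('a \<Rightarrow> ereal) \<Rightarrow> ('a \<Rightarrow> ereal) \<Rightarrow> ereal" where
  "Theta_dagger U \<phi>1 \<phi>2 =
     (SUP V\<in>EI U. limsup_close_nonneg (edom \<phi>1 \<inter> V) (edom \<phi>2 \<inter> V) (diamond U \<phi>1 \<phi>2))"

definition uniformly_lsc ::
  "'a::metric_space set \<Rightarrow> ('a \<Rightarrow> ereal) \<Rightarrow> ('a \<Rightarrow> ereal) \<Rightarrow> bool" where
  "uniformly_lsc U \<phi>1 \<phi>2 \<longleftrightarrow> (INF x\<in>U. \<phi>1 x + \<phi>2 x) \<le> Lambda_circ U \<phi>1 \<phi>2"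

definition quasiuniformly_lsc ::
  "'a::metric_space set \<Rightarrow> ('a \<Rightarrow> ereal) \<Rightarrow> ('a \<Rightarrow> ereal) \<Rightarrow> bool" where
  "quasiuniformly_lsc U \<phi>1 \<phi>2 \<longleftrightarrow> (INF x\<in>U. \<phi>1 x + \<phi>2 x) \<le> Lambda_dagger U \<phi>1 \<phi>2"

definition firmly_uniformly_lsc ::
  "'a::metric_space set \<Rightarrow> ('a \<Rightarrow> ereal) \<Rightarrow> ('a \<Rightarrow> ereal) \<Rightarrow> bool" where
  "firmly_uniformly_lsc U \<phi>1 \<phi>2 \<longleftrightarrow> Theta_circ U \<phi>1 \<phi>2 = 0"

definition firmly_quasiuniformly_lsc ::
  "'a::metric_space set \<Rightarrow> ('a \<Rightarrow> ereal) \<Rightarrow> ('a \<Rightarrow> ereal) \<Rightarrow> bool" where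
  "firmly_quasiuniformly_lsc U \<phi>1 \<phi>2 \<longleftrightarrow> Theta_dagger U \<phi>1 \<phi>2 = 0"

end

theory Submission
  imports Defs
begin

text \<open>Each of the four claims is an instance of one compactness argument. If a claim fails, there
  are pairs \<open>(x1, x2)\<close> of points of a set \<open>V\<close>, at arbitrarily small distance, that violate the
  required estimate. Along these pairs \<open>\<phi>1 x1 + \<phi>2 x2\<close> is bounded above: in the two claims
  about the lower limit because it stays below a number smaller than the infimum, in the two firm
  ones by the additional condition on the upper limit. As \<open>\<phi>2\<close> is bounded below on \<open>U\<close>, the
  points \<open>x1\<close> then lie in a single sublevel set of \<open>\<phi>1\<close>. That set is compact, so the points
  \<open>x1\<close> have a cluster point \<open>x\<close>, which is also a cluster point of the points \<open>x2\<close>. This is \<open>cluster_point_of_close_pairs\<close>; lower semicontinuity is used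
  there to bring \<open>\<phi>1 x1\<close> and \<open>\<phi>2 x2\<close> above any levels strictly below \<open>\<phi>1 x\<close> and \<open>\<phi>2 x\<close>.

  At such a point the violation is impossible. The lower limit of \<open>\<phi>1 x1 + \<phi>2 x2\<close> is at least
  \<open>\<phi>1 x + \<phi>2 x\<close>, hence at least the infimum over \<open>U\<close> (\<open>INF_le_Lambda_circ\<close>); and \<open>x\<close> itself is
  a candidate in the infimum that defines \<^const>\<open>diamond\<close>, of value at most \<open>\<epsilon>\<close> for some of the
  violating pairs, for any given \<open>\<epsilon> > 0\<close>
  (\<open>limsup_close_nonneg_diamond_eq_0\<close>).

  Both statements are proved for sets \<open>V \<subseteq> W \<subseteq> U\<close> where the sublevel sets of \<open>\<phi>1\<close> in \<open>W\<close> are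
  compact. The uniform notions are the case \<open>V = W = U\<close>. The quasiuniform ones are the case of an
  essentially interior \<open>V\<close> and \<open>W = closure V\<close>, which lies in \<open>U\<close> because a ball of fixed radius
  around every point of \<open>V\<close> does.\<close>

section \<open>Cluster points of close pairs\<close>

lemma lsc_onD:
  fixes \<phi> :: "'a::metric_space \<Rightarrow> ereal"
  assumes "lsc_on U \<phi>" "x \<in> U" "a < \<phi> x"
  obtains \<delta> where "\<delta> > 0" "\<And>y. y \<in> U \<Longrightarrow> dist x y < \<delta> \<Longrightarrow> a < \<phi> y"
proof -
  have "\<forall>\<^sub>F y in at x within U. a < \<phi> y"
    using assms unfolding lsc_on_def le_Liminf_iff by blast
  then obtain \<delta> where "\<delta> > 0" "\<And>y. y \<in> U \<Longrightarrow> y \<noteq> x \<Longrightarrow> dist y x < \<delta> \<Longrightarrow> a < \<phi> y"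
    unfolding eventually_at by blast
  with \<open>a < \<phi> x\<close> show thesis
    by (metis dist_commute that)
qed

lemma closure_subset_of_EI:
  assumes "V \<in> EI U"
  shows "closure V \<subseteq> U"
proof
  fix x assume x: "x \<in> closure V"
  from assms obtain \<rho> where \<rho>: "\<rho> > 0" "(\<Union>v\<in>V. ball v \<rho>) \<subseteq> U"
    by (auto simp: EI_def)
  with x obtain v where "v \<in> V" "dist v x < \<rho>"
    by (auto simp: closure_approachable)
  with \<rho> show "x \<in> U"
    by (auto simp: subset_iff)
qed

text \<open>The predicate \<open>P\<close> stands for the violated estimate, so that one extraction of a cluster point
  serves the lower limit as well as the diamond quantity. The conclusion speaks of levels \<open>a1\<close> and
  \<open>a2\<close> instead of lower limits along a subsequence, so that a contradiction can be drawn from a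
  single pair near \<open>x\<close>.\<close>

lemma cluster_point_of_close_pairs:
  fixes \<phi>1 \<phi>2 :: "'a::metric_space \<Rightarrow> ereal"
  assumes lsc: "lsc_on U \<phi>1" "lsc_on U \<phi>2"
    and sub: "V \<subseteq> W" "W \<subseteq> U"
    and compact: "compact {x \<in> W. \<phi>1 x \<le> c}"
    and P_le: "\<And>x1 x2. x1 \<in> V \<Longrightarrow> x2 \<in> V \<Longrightarrow> P x1 x2 \<Longrightarrow> \<phi>1 x1 \<le> c"
    and P_close: "\<And>\<eta>. \<eta> > 0 \<Longrightarrow> \<exists>(x1, x2)\<in>close_pairs V V \<eta>. P x1 x2"
  obtains x where "x \<in> U" "\<phi>1 x \<le> c"
    and "\<And>\<epsilon> a1 a2. \<epsilon> > 0 \<Longrightarrow> a1 < \<phi>1 x \<Longrightarrow> a2 < \<phi>2 x \<Longrightarrow>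
      \<exists>x1\<in>V. \<exists>x2\<in>V. P x1 x2 \<and> dist x x1 < \<epsilon> \<and> dist x x2 < \<epsilon> \<and> a1 < \<phi>1 x1 \<and> a2 < \<phi>2 x2"
proof -
  let ?K = "{x \<in> W. \<phi>1 x \<le> c}"
  have "\<forall>n. \<exists>x1\<in>V. \<exists>x2\<in>V. dist x1 x2 < inverse (real (Suc n)) \<and> P x1 x2"
    using P_close[of "inverse (real (Suc n))" for n] by (fastforce simp: close_pairs_def)
  then obtain p q where pq: "\<And>n. p n \<in> V" "\<And>n. q n \<in> V" "\<And>n. P (p n) (q n)"
    and dist: "\<And>n. dist (p n) (q n) < inverse (real (Suc n))"
    by metis
  have "\<forall>n. p n \<in> ?K"
    using pq P_le sub by blast
  with compact obtain x r where x: "x \<in> ?K" and r: "strict_mono r" and px: "(p \<circ> r) \<longlonglongrightarrow> x"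
    unfolding compact_def by metis
  have "(\<lambda>n. dist (p n) (q n)) \<longlonglongrightarrow> 0"
    by (rule tendsto_sandwich[OF _ _ tendsto_const LIMSEQ_inverse_real_of_nat])
       (auto intro!: always_eventually less_imp_le[OF dist] simp del: of_nat_Suc)
  then have dist_r: "(\<lambda>n. dist (p (r n)) (q (r n))) \<longlonglongrightarrow> 0"
    using LIMSEQ_subseq_LIMSEQ[OF _ r] by (auto simp: o_def)
  show thesis
  proof (rule that)
    show "x \<in> U" "\<phi>1 x \<le> c"
      using x sub by auto
    fix \<epsilon> :: real and a1 a2 assume "\<epsilon> > 0" and a: "a1 < \<phi>1 x" "a2 < \<phi>2 x"
    obtain \<delta>1 where \<delta>1: "\<delta>1 > 0" "\<And>y. y \<in> U \<Longrightarrow> dist x y < \<delta>1 \<Longrightarrow> a1 < \<phi>1 y"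
      using lsc_onD[OF lsc(1) \<open>x \<in> U\<close> a(1)] by blast
    obtain \<delta>2 where \<delta>2: "\<delta>2 > 0" "\<And>y. y \<in> U \<Longrightarrow> dist x y < \<delta>2 \<Longrightarrow> a2 < \<phi>2 y"
      using lsc_onD[OF lsc(2) \<open>x \<in> U\<close> a(2)] by blast
    define \<delta> where "\<delta> = min \<epsilon> (min \<delta>1 \<delta>2)"
    have half: "\<delta> / 2 > 0"
      using \<open>\<epsilon> > 0\<close> \<delta>1 \<delta>2 by (simp add: \<delta>_def)
    have "\<forall>\<^sub>F n in sequentially. dist (p (r n)) x < \<delta> / 2"
      and "\<forall>\<^sub>F n in sequentially. dist (p (r n)) (q (r n)) < \<delta> / 2"
      using tendstoD[OF px half] order_tendstoD(2)[OF dist_r half] by (simp_all only: o_def)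
    then have "\<forall>\<^sub>F n in sequentially. dist (p (r n)) x < \<delta> / 2 \<and> dist (p (r n)) (q (r n)) < \<delta> / 2"
      by (rule eventually_conj)
    then obtain n where n: "dist (p (r n)) x < \<delta> / 2" "dist (p (r n)) (q (r n)) < \<delta> / 2"
      using eventually_happens'[OF sequentially_bot] by blast
    have "dist x (q (r n)) \<le> dist (p (r n)) x + dist (p (r n)) (q (r n))"
      by (metis dist_commute dist_triangle)
    with n have "dist x (p (r n)) < \<delta>" "dist x (q (r n)) < \<delta>"
      using half by (simp_all add: dist_commute)
    moreover have "p (r n) \<in> U" "q (r n) \<in> U"
      using pq sub by blast+
    ultimately show "\<exists>x1\<in>V. \<exists>x2\<in>V. P x1 x2 \<and> dist x x1 < \<epsilon> \<and> dist x x2 < \<epsilon> \<and>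
        a1 < \<phi>1 x1 \<and> a2 < \<phi>2 x2"
      using pq[of "r n"] \<delta>1(2) \<delta>2(2) unfolding \<delta>_def
      by (intro bexI[of _ "p (r n)"] bexI[of _ "q (r n)"]) auto
  qed
qed

section \<open>Lower limits of sums\<close>

text \<open>This is where the lower bound on \<open>\<phi>2\<close> enters: it turns a bound on the sum into membership in
  a sublevel set of \<open>\<phi>1\<close>.\<close>

lemma ereal_le_diff_of_add_le:
  fixes u v :: ereal
  assumes "ereal b \<le> v" "u + v \<le> ereal C"
  shows "u \<le> ereal (C - b)"
  using assms by (cases u; cases v) auto

text \<open>If the lower limit were smaller than some \<open>m\<close> below the infimum, the sum would be smaller
  than \<open>m\<close> along close pairs, whereas at their cluster point it exceeds \<open>m\<close>; lower
  semicontinuity excludes this.\<close>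

lemma INF_le_Lambda_circ:
  fixes \<phi>1 \<phi>2 :: "'a::metric_space \<Rightarrow> ereal"
  assumes proper: "\<And>x. \<phi>1 x \<noteq> -\<infinity>"
    and lsc: "lsc_on U \<phi>1" "lsc_on U \<phi>2"
    and sub: "V \<subseteq> W" "W \<subseteq> U"
    and compact: "\<And>c::real. compact {x \<in> W. \<phi>1 x \<le> ereal c}"
    and bound: "\<And>x. x \<in> U \<Longrightarrow> ereal b \<le> \<phi>2 x"
  shows "(INF x\<in>U. \<phi>1 x + \<phi>2 x) \<le> Lambda_circ V \<phi>1 \<phi>2"
proof (rule ccontr)
  assume "\<not> ?thesis"
  then obtain m where m: "Lambda_circ V \<phi>1 \<phi>2 < ereal m" "ereal m < (INF x\<in>U. \<phi>1 x + \<phi>2 x)"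
    using ereal_dense2 by (auto simp: not_le)
  have *: "\<exists>(x1, x2)\<in>close_pairs V V \<eta>. \<phi>1 x1 + \<phi>2 x2 < ereal m" if "\<eta> > 0" for \<eta>
  proof -
    have "(INF (x1, x2)\<in>close_pairs V V \<eta>. \<phi>1 x1 + \<phi>2 x2) \<le> Lambda_circ V \<phi>1 \<phi>2"
      unfolding Lambda_circ_def liminf_close_eq using that by (intro SUP_upper2[of \<eta>]) auto
    also note m(1)
    finally show ?thesis
      by (auto simp: INF_less_iff)
  qed
  have **: "\<phi>1 x1 \<le> ereal (m - b)" if "\<phi>1 x1 + \<phi>2 x2 < ereal m" "x2 \<in> V" for x1 x2
    using that bound[of x2] sub by (intro ereal_le_diff_of_add_le[of b "\<phi>2 x2"]) auto
  obtain x where x: "x \<in> U" "\<phi>1 x \<le> ereal (m - b)"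
    and near: "\<And>\<epsilon> a1 a2. \<epsilon> > 0 \<Longrightarrow> a1 < \<phi>1 x \<Longrightarrow> a2 < \<phi>2 x \<Longrightarrow>
      \<exists>x1\<in>V. \<exists>x2\<in>V. \<phi>1 x1 + \<phi>2 x2 < ereal m \<and> dist x x1 < \<epsilon> \<and> dist x x2 < \<epsilon> \<and>
        a1 < \<phi>1 x1 \<and> a2 < \<phi>2 x2"
    by (rule cluster_point_of_close_pairs[where P = "\<lambda>x1 x2. \<phi>1 x1 + \<phi>2 x2 < ereal m",
          OF lsc sub compact])
       (use ** * in blast)+
  obtain r where r: "\<phi>1 x = ereal r"
    using x(2) proper[of x] by (cases "\<phi>1 x") auto
  \<comment> \<open>Split the level \<open>m\<close> into two summands lying strictly below the values at \<open>x\<close>.\<close>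
  have "ereal m < ereal r + \<phi>2 x"
    using m(2) x(1) r by (metis INF_lower less_le_trans)
  then have "ereal (m - r) < \<phi>2 x"
    by (cases "\<phi>2 x") auto
  then obtain a where a: "ereal (m - r) < ereal a" "ereal a < \<phi>2 x"
    using ereal_dense2 by blast
  then have "ereal (m - a) < \<phi>1 x"
    by (simp add: r)
  from near[OF zero_less_one this a(2)] obtain x1 x2
    where "\<phi>1 x1 + \<phi>2 x2 < ereal m" "ereal (m - a) < \<phi>1 x1" "ereal a < \<phi>2 x2"
    by blast
  then show False
    by (cases "\<phi>1 x1"; cases "\<phi>2 x2") auto
qed

section \<open>Upper limits of the diamond quantity\<close>

lemma limsup_close_less_PInfD:
  assumes "limsup_close A B f < \<infinity>"
  obtains \<eta> C where "\<eta> > 0" "\<And>x1 x2. (x1, x2) \<in> close_pairs A B \<eta> \<Longrightarrow> f x1 x2 \<le> ereal C"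
proof -
  from assms obtain \<eta> where \<eta>: "\<eta> > 0" "(SUP (x1, x2)\<in>close_pairs A B \<eta>. f x1 x2) < \<infinity>"
    unfolding limsup_close_eq INF_less_iff by blast
  then obtain C where "(SUP (x1, x2)\<in>close_pairs A B \<eta>. f x1 x2) < ereal C"
    using ereal_dense2 by blast
  then have "f x1 x2 \<le> ereal C" if "(x1, x2) \<in> close_pairs A B \<eta>" for x1 x2
    using that by (auto simp: SUP_le_iff dest!: less_imp_le)
  with \<eta>(1) show thesis
    by (rule that)
qed

lemma limsup_close_mono:
  assumes "A \<subseteq> A'" "B \<subseteq> B'"
  shows "limsup_close A B f \<le> limsup_close A' B' f"
  unfolding limsup_close_eq using assms
  by (intro INF_mono' SUP_subset_mono) (auto simp: close_pairs_def)

lemma limsup_close_nonneg_eq_0I: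
  assumes nonneg: "\<And>x1 x2. x1 \<in> A \<Longrightarrow> x2 \<in> B \<Longrightarrow> 0 \<le> f x1 x2"
    and small: "\<And>\<epsilon>. \<epsilon> > 0 \<Longrightarrow> \<exists>\<eta>>0. \<forall>(x1, x2)\<in>close_pairs A B \<eta>. f x1 x2 \<le> ereal \<epsilon>"
  shows "limsup_close_nonneg A B f = 0"
proof -
  let ?S = "\<lambda>\<eta>. Sup_nonneg ((\<lambda>(x1, x2). f x1 x2) ` close_pairs A B \<eta>)"
  have S_nonneg: "0 \<le> ?S \<eta>" for \<eta>
    using nonneg by (auto simp: Sup_nonneg_def close_pairs_def intro: Sup_upper2)
  have le: "(INF \<eta>\<in>{0<..}. ?S \<eta>) \<le> ereal \<epsilon>" if \<epsilon>: "\<epsilon> > 0" for \<epsilon>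
  proof -
    from small[OF \<epsilon>] obtain \<eta> where \<eta>: "\<eta> > 0" "\<forall>(x1, x2)\<in>close_pairs A B \<eta>. f x1 x2 \<le> ereal \<epsilon>"
      by blast
    then have "?S \<eta> \<le> ereal \<epsilon>"
      using \<epsilon> by (auto simp: Sup_nonneg_def intro!: Sup_least)
    with \<eta>(1) show ?thesis
      by (intro INF_lower2[of \<eta>]) auto
  qed
  have "(INF \<eta>\<in>{0<..}. ?S \<eta>) \<le> 0"
    by (rule ereal_le_epsilon2) (simp add: le)
  moreover have "0 \<le> (INF \<eta>\<in>{0<..}. ?S \<eta>)"
    using S_nonneg by (rule INF_greatest)
  ultimately have "(INF \<eta>\<in>{0<..}. ?S \<eta>) = 0"
    by (rule antisym)
  then show ?thesis
    using limsup_close_nonneg_eq[of A B f] nonneg by simp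
qed

text \<open>The bound on the upper limit is used twice: it confines the first components to one compact
  sublevel set, and it makes \<open>\<phi>2\<close> finite at the cluster point. Only then is the increment of
  \<open>\<phi>1 + \<phi>2\<close> from a nearby pair to the cluster point small, since each of the two terms can lie
  above its value at the pair by at most \<open>\<epsilon> / 2\<close>.\<close>

lemma limsup_close_nonneg_diamond_eq_0:
  fixes \<phi>1 \<phi>2 :: "'a::metric_space \<Rightarrow> ereal"
  assumes proper: "\<And>x. \<phi>1 x \<noteq> -\<infinity>" "\<And>x. \<phi>2 x \<noteq> -\<infinity>"
    and lsc: "lsc_on U \<phi>1" "lsc_on U \<phi>2"
    and sub: "V \<subseteq> W" "W \<subseteq> U"
    and compact: "\<And>c::real. compact {x \<in> W. \<phi>1 x \<le> ereal c}"
    and bound: "\<And>x. x \<in> U \<Longrightarrow> ereal b \<le> \<phi>2 x"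
    and limsup: "limsup_close (edom \<phi>1 \<inter> V) (edom \<phi>2 \<inter> V) (\<lambda>x1 x2. \<phi>1 x1 + \<phi>2 x2) < \<infinity>"
  shows "limsup_close_nonneg (edom \<phi>1 \<inter> V) (edom \<phi>2 \<inter> V) (diamond U \<phi>1 \<phi>2) = 0"
proof (rule limsup_close_nonneg_eq_0I[OF diamond_nonneg], rule ccontr)
  fix \<epsilon> :: real
  let ?A = "edom \<phi>1 \<inter> V" and ?B = "edom \<phi>2 \<inter> V"
  assume "\<epsilon> > 0"
    and neg: "\<not> (\<exists>\<eta>>0. \<forall>(x1, x2)\<in>close_pairs ?A ?B \<eta>. diamond U \<phi>1 \<phi>2 x1 x2 \<le> ereal \<epsilon>)"
  from limsup obtain \<eta>0 C where \<eta>0: "\<eta>0 > 0"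
    and C: "\<And>x1 x2. (x1, x2) \<in> close_pairs ?A ?B \<eta>0 \<Longrightarrow> \<phi>1 x1 + \<phi>2 x2 \<le> ereal C"
    by (rule limsup_close_less_PInfD) blast
  define P where "P x1 x2 \<longleftrightarrow> x1 \<in> edom \<phi>1 \<and> x2 \<in> edom \<phi>2 \<and> \<phi>1 x1 + \<phi>2 x2 \<le> ereal C \<and>
    \<not> diamond U \<phi>1 \<phi>2 x1 x2 \<le> ereal \<epsilon>" for x1 x2
  have P_close: "\<exists>(x1, x2)\<in>close_pairs V V \<eta>. P x1 x2" if "\<eta> > 0" for \<eta>
  proof -
    have "min \<eta> \<eta>0 > 0"
      using that \<eta>0 by simp
    with neg obtain x1 x2 where x12: "(x1, x2) \<in> close_pairs ?A ?B (min \<eta> \<eta>0)"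
      "\<not> diamond U \<phi>1 \<phi>2 x1 x2 \<le> ereal \<epsilon>"
      by blast
    moreover from x12 have "\<phi>1 x1 + \<phi>2 x2 \<le> ereal C"
      by (intro C) (auto simp: close_pairs_def)
    ultimately show ?thesis
      by (intro bexI[of _ "(x1, x2)"]) (auto simp: close_pairs_def P_def)
  qed
  have P_le: "\<phi>1 x1 \<le> ereal (C - b)" if "P x1 x2" "x2 \<in> V" for x1 x2
    using that bound[of x2] sub unfolding P_def
    by (intro ereal_le_diff_of_add_le[of b "\<phi>2 x2"]) auto
  obtain x where x: "x \<in> U" "\<phi>1 x \<le> ereal (C - b)"
    and near: "\<And>\<epsilon> a1 a2. \<epsilon> > 0 \<Longrightarrow> a1 < \<phi>1 x \<Longrightarrow> a2 < \<phi>2 x \<Longrightarrow>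
      \<exists>x1\<in>V. \<exists>x2\<in>V. P x1 x2 \<and> dist x x1 < \<epsilon> \<and> dist x x2 < \<epsilon> \<and> a1 < \<phi>1 x1 \<and> a2 < \<phi>2 x2"
    by (rule cluster_point_of_close_pairs[where P = P, OF lsc sub compact])
       (use P_le P_close in blast)+
  obtain r1 where r1: "\<phi>1 x = ereal r1"
    using x(2) proper(1)[of x] by (cases "\<phi>1 x") auto
  \<comment> \<open>Near \<open>x\<close> the values of \<open>\<phi>1\<close> exceed \<open>r1 - 1\<close> and the sums are at most \<open>C\<close>, so the
    values of \<open>\<phi>2\<close> cannot exceed \<open>C - (r1 - 1)\<close>, which they would if \<open>\<phi>2 x\<close> were infinite.\<close>
  have "\<phi>2 x \<noteq> \<infinity>"
  proof
    assume "\<phi>2 x = \<infinity>"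
    then obtain x1 x2 where "P x1 x2" "ereal (r1 - 1) < \<phi>1 x1" "ereal (C - (r1 - 1)) < \<phi>2 x2"
      using near[of 1 "ereal (r1 - 1)" "ereal (C - (r1 - 1))"] r1 by auto
    then show False
      unfolding P_def by (cases "\<phi>1 x1"; cases "\<phi>2 x2") auto
  qed
  then obtain r2 where r2: "\<phi>2 x = ereal r2"
    using proper(2)[of x] by (cases "\<phi>2 x") auto
  obtain x1 x2 where P: "P x1 x2" and dist: "dist x x1 < \<epsilon>" "dist x x2 < \<epsilon>"
    and less: "ereal (r1 - \<epsilon> / 2) < \<phi>1 x1" "ereal (r2 - \<epsilon> / 2) < \<phi>2 x2"
    using near[of \<epsilon> "ereal (r1 - \<epsilon> / 2)" "ereal (r2 - \<epsilon> / 2)"] r1 r2 \<open>\<epsilon> > 0\<close> by auto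
  obtain s1 s2 where "\<phi>1 x1 = ereal s1" "\<phi>2 x2 = ereal s2"
    using P less unfolding P_def edom_def by (cases "\<phi>1 x1"; cases "\<phi>2 x2") auto
  with less have "(\<phi>1 x + \<phi>2 x) - \<phi>1 x1 - \<phi>2 x2 \<le> ereal \<epsilon>"
    by (simp add: r1 r2)
  with dist x(1) have "diamond U \<phi>1 \<phi>2 x1 x2 \<le> ereal \<epsilon>"
    unfolding diamond_def by (intro INF_lower2[of x]) auto
  with P show False
    by (simp add: P_def)
qed

section \<open>Compactness criteria for uniform lower semicontinuity\<close>

theorem proposition4p10:
  fixes \<phi>1 \<phi>2 :: "'a::metric_space \<Rightarrow> ereal" and U :: "'a set"
  assumes "\<And>x. \<phi>1 x \<noteq> -\<infinity>" and "\<And>x. \<phi>2 x \<noteq> -\<infinity>"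
    and "edom \<phi>1 \<inter> edom \<phi>2 \<inter> U \<noteq> {}"
    and "lsc_on U \<phi>1" and "lsc_on U \<phi>2"
    and "(INF x\<in>U. \<phi>2 x) > -\<infinity>"
  shows
    "((\<forall>c::real. compact {x \<in> U. \<phi>1 x \<le> ereal c}) \<longrightarrow>
        uniformly_lsc U \<phi>1 \<phi>2 \<and>
        (limsup_close (edom \<phi>1 \<inter> U) (edom \<phi>2 \<inter> U) (\<lambda>x1 x2. \<phi>1 x1 + \<phi>2 x2) < \<infinity> \<longrightarrow>
          firmly_uniformly_lsc U \<phi>1 \<phi>2)) \<and>
     ((\<forall>V\<in>EI U. \<forall>c::real. compact {x \<in> closure V. \<phi>1 x \<le> ereal c}) \<longrightarrow>
        quasiuniformly_lsc U \<phi>1 \<phi>2 \<and>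
        ((SUP V\<in>EI U. limsup_close (edom \<phi>1 \<inter> V) (edom \<phi>2) (\<lambda>x1 x2. \<phi>1 x1 + \<phi>2 x2)) < \<infinity> \<longrightarrow>
          firmly_quasiuniformly_lsc U \<phi>1 \<phi>2))"
proof (intro conjI impI)
  obtain b where "ereal b < (INF x\<in>U. \<phi>2 x)"
    using assms(6) ereal_dense2 by blast
  then have bound: "ereal b \<le> \<phi>2 x" if "x \<in> U" for x
    using that by (meson INF_lower less_imp_le less_le_trans)
  note Lambda = INF_le_Lambda_circ[OF assms(1) assms(4,5) _ _ _ bound]
  note Theta = limsup_close_nonneg_diamond_eq_0[OF assms(1,2) assms(4,5) _ _ _ bound]
  {
    assume "\<forall>c::real. compact {x \<in> U. \<phi>1 x \<le> ereal c}"
    then have compact: "compact {x \<in> U. \<phi>1 x \<le> ereal c}" for c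
      by blast
    show "uniformly_lsc U \<phi>1 \<phi>2"
      unfolding uniformly_lsc_def by (rule Lambda[OF order_refl order_refl compact])
    assume "limsup_close (edom \<phi>1 \<inter> U) (edom \<phi>2 \<inter> U) (\<lambda>x1 x2. \<phi>1 x1 + \<phi>2 x2) < \<infinity>"
    then show "firmly_uniformly_lsc U \<phi>1 \<phi>2"
      unfolding firmly_uniformly_lsc_def Theta_circ_def
      by (intro Theta[OF order_refl order_refl compact])
  next
    assume "\<forall>V\<in>EI U. \<forall>c::real. compact {x \<in> closure V. \<phi>1 x \<le> ereal c}"
    then have compact: "compact {x \<in> closure V. \<phi>1 x \<le> ereal c}" if "V \<in> EI U" for V c
      using that by blast
    show "quasiuniformly_lsc U \<phi>1 \<phi>2"
      unfolding quasiuniformly_lsc_def Lambda_dagger_def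
      by (intro INF_greatest Lambda[OF closure_subset closure_subset_of_EI compact])
    assume *: "(SUP V\<in>EI U. limsup_close (edom \<phi>1 \<inter> V) (edom \<phi>2) (\<lambda>x1 x2. \<phi>1 x1 + \<phi>2 x2)) < \<infinity>"
    have "limsup_close_nonneg (edom \<phi>1 \<inter> V) (edom \<phi>2 \<inter> V) (diamond U \<phi>1 \<phi>2) = 0"
      if V: "V \<in> EI U" for V
    proof (rule Theta[OF closure_subset closure_subset_of_EI[OF V] compact[OF V]])
      have "limsup_close (edom \<phi>1 \<inter> V) (edom \<phi>2 \<inter> V) (\<lambda>x1 x2. \<phi>1 x1 + \<phi>2 x2) \<le>
          limsup_close (edom \<phi>1 \<inter> V) (edom \<phi>2) (\<lambda>x1 x2. \<phi>1 x1 + \<phi>2 x2)"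
        by (intro limsup_close_mono) auto
      also have "\<dots> \<le> (SUP V\<in>EI U. limsup_close (edom \<phi>1 \<inter> V) (edom \<phi>2) (\<lambda>x1 x2. \<phi>1 x1 + \<phi>2 x2))"
        using V by (rule SUP_upper)
      also note *
      finally show "limsup_close (edom \<phi>1 \<inter> V) (edom \<phi>2 \<inter> V) (\<lambda>x1 x2. \<phi>1 x1 + \<phi>2 x2) < \<infinity>" .
    qed
    \<comment> \<open>The empty set is essentially interior, so this supremum is not the one over an empty
      family, which would be \<open>-\<infinity>\<close>.\<close>
    moreover have "EI U \<noteq> {}"
      by (auto simp: EI_def intro!: exI[of _ "{}"] exI[of _ "1::real"])
    ultimately show "firmly_quasiuniformly_lsc U \<phi>1 \<phi>2"
      unfolding firmly_quasiuniformly_lsc_def Theta_dagger_def by simp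
  }
qed

end
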